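(* There exist a Stackelberg game $\mathcal{G} = (\mathcal{A}, \mathcal{A}_f, \mathcal{Z}, u, u_{f^{(1)}}, \ldots, u_{f^{(K)}})$ whose follower types are pairwise distinct and a hypothesis class $\mathcal{H} \subseteq [K]^{\mathcal{Z}}$ such that $\mathrm{Ldim}(\mathcal{H}) = \infty$, but the leader's optimal policy can be determined without learning, i.e. there is a single policy $\pi : \mathcal{Z} \to \Delta(\mathcal{A})$ with $$r(\mathbf{z}, \pi(\mathbf{z}), f^{(h(\mathbf{z}))}) = 0 \quad \text{for every } h \in \mathcal{H} \text{ and every } \mathbf{z} \in \mathcal{Z}.$$
   Context: Stackelberg game. A (contextual) Stackelberg game is a tuple $\mathcal{G} = (\mathcal{A}, \mathcal{A}_f, \mathcal{Z}, u, u_{f^{(1)}}, \ldots, u_{f^{(K)}})$, where $\mathcal{A}$ and $\mathcal{A}_f$ are the finite nonempty action sets of the leader and the follower, $\mathcal{Z} \subseteq \mathbb{R}^d$ is the set of contexts, $u : \mathcal{Z} \times \mathcal{A} \times \mathcal{A}_f \to [0,1]$ is the leader's utility, and $u_{f^{(i)}} : \mathcal{Z} \times \mathcal{A} \times \mathcal{A}_f \to [0,1]$ is the utility of a follower of type $f^{(i)}$, $i \in [K] = \{1,\ldots,K\}$. $\Delta(\mathcal{A})$ is the probability simplex over $\mathcal{A}$ (leader mixed strategies), and $u(\mathbf{z}, \mathbf{x}, a_f) := \sum_{a_l \in \mathcal{A}} \mathbf{x}[a_l]\, u(\mathbf{z}, a_l, a_f)$ for $\mathbf{x} \in \Delta(\mathcal{A})$.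 The best response of type $f^{(i)}$ is $b_{f^{(i)}}(\mathbf{z}, \mathbf{x}) \in \arg\max_{a_f \in \mathcal{A}_f} \sum_{a_l} \mathbf{x}[a_l]\, u_{f^{(i)}}(\mathbf{z}, a_l, a_f)$, ties being broken by a fixed, known, deterministic order on $\mathcal{A}_f$. Loss. $r(\mathbf{z}, \mathbf{x}, f^{(i)}) := \sup_{\mathbf{x}' \in \Delta(\mathcal{A})} u(\mathbf{z}, \mathbf{x}', b_{f^{(i)}}(\mathbf{z}, \mathbf{x}')) - u(\mathbf{z}, \mathbf{x}, b_{f^{(i)}}(\mathbf{z}, \mathbf{x}))$. A strategy $\mathbf{x}$ is optimal against type $f^{(i)}$ at $\mathbf{z}$ if $r(\mathbf{z},\mathbf{x},f^{(i)})=0$. Distinct types. Two follower types are distinct if there exists some context for which no single leader strategy is simultaneously optimal against both types. Hypothesis class. $\mathcal{H} \subseteq [K]^{\mathcal{Z}}$; $h(\mathbf{z}) = i$ means that $h$ predicts type $f^{(i)}$ at context $\mathbf{z}$. Littlestone dimension. A Littlestone tree is a rooted tree in which each internal node is labeled with an element of $\mathcal{Z}$ and each edge corresponds to a label in $[K]$, distinct edges leaving the same node having distinct labels. It is shattered by $\mathcal{H}$ if for every root-to-leaf path traversing internal nodes $\mathbf{z}_1, \ldots, \mathbf{z}_n$ there is $h \in \mathcal{H}$ such that the label of the edge of the path leaving $\mathbf{z}_i$ is $h(\mathbf{z}_i)$ for all $i$. $\mathrm{Ldim}(\mathcal{H})$ is the maximal integer $d$ such that there is a full binary tree of depth $d$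 shattered by $\mathcal{H}$ ($\infty$ if there are such trees of arbitrarily large depth). *)

theory Defs
  imports Jordan_Normal_Form.Matrix "HOL-Library.FuncSet" "HOL-Library.Extended_Nat"
begin

text \<open>
  \<open>follower_util G i\<close> is the utility function of follower type \<open>i\<close>, where \<open>i\<close> ranges over
  \<open>{1..num_types G}\<close>.  The order used to break the follower's ties is stored in the record;
  \<open>(b, b') \<in> tie_order G\<close> means that \<open>b\<close> is preferred to \<open>b'\<close>.
\<close>

record ('z, 'a, 'b) stackelberg =
  leader_actions :: "'a set"
  follower_actions :: "'b set"
  contexts :: "'z set"
  num_types :: nat
  leader_util :: "'z \<Rightarrow> 'a \<Rightarrow> 'b \<Rightarrow> real"
  follower_util :: "nat \<Rightarrow> 'z \<Rightarrow> 'a \<Rightarrow> 'b \<Rightarrow> real"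
  tie_order :: "'b rel"

definition types :: "('z, 'a, 'b) stackelberg \<Rightarrow> nat set" where
  "types G = {1..num_types G}"

definition stackelberg_game :: "('z, 'a, 'b) stackelberg \<Rightarrow> bool" where
  "stackelberg_game G \<longleftrightarrow>
     finite (leader_actions G) \<and> leader_actions G \<noteq> {} \<and>
     finite (follower_actions G) \<and> follower_actions G \<noteq> {} \<and>
     (\<forall>z\<in>contexts G. \<forall>a\<in>leader_actions G. \<forall>b\<in>follower_actions G.
        leader_util G z a b \<in> {0..1} \<and>
        (\<forall>i\<in>types G. follower_util G i z a b \<in> {0..1})) \<and>
     linear_order_on (follower_actions G) (tie_order G)"

definition prob_simplex :: "'a set \<Rightarrow> ('a \<Rightarrow> real) set" where
  "prob_simplex A = {x \<in> A \<rightarrow>\<^sub>E {0..}. (\<Sum>a\<in>A. x a) = 1}"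

abbreviation strategies :: "('z, 'a, 'b) stackelberg \<Rightarrow> ('a \<Rightarrow> real) set" where
  "strategies G \<equiv> prob_simplex (leader_actions G)"

definition mixed_util ::
  "('z, 'a, 'b) stackelberg \<Rightarrow> ('z \<Rightarrow> 'a \<Rightarrow> 'b \<Rightarrow> real) \<Rightarrow> 'z \<Rightarrow> ('a \<Rightarrow> real) \<Rightarrow> 'b \<Rightarrow> real" where
  "mixed_util G v z x b = (\<Sum>a\<in>leader_actions G. x a * v z a b)"

definition best_responses ::
  "('z, 'a, 'b) stackelberg \<Rightarrow> nat \<Rightarrow> 'z \<Rightarrow> ('a \<Rightarrow> real) \<Rightarrow> 'b set" where
  "best_responses G i z x =
     {b \<in> follower_actions G. \<forall>b'\<in>follower_actions G.
        mixed_util G (follower_util G i) z x b' \<le> mixed_util G (follower_util G i) z x b}"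

definition best_response ::
  "('z, 'a, 'b) stackelberg \<Rightarrow> nat \<Rightarrow> 'z \<Rightarrow> ('a \<Rightarrow> real) \<Rightarrow> 'b" where
  "best_response G i z x =
     (THE b. b \<in> best_responses G i z x \<and>
             (\<forall>b'\<in>best_responses G i z x. (b, b') \<in> tie_order G))"

text \<open>The utility that the leader obtains by committing to \<open>x\<close> against type \<open>i\<close>.\<close>

definition induced_util ::
  "('z, 'a, 'b) stackelberg \<Rightarrow> 'z \<Rightarrow> ('a \<Rightarrow> real) \<Rightarrow> nat \<Rightarrow> real" where
  "induced_util G z x i = mixed_util G (leader_util G) z x (best_response G i z x)"

definition loss :: "('z, 'a, 'b) stackelberg \<Rightarrow> 'z \<Rightarrow> ('a \<Rightarrow> real) \<Rightarrow> nat \<Rightarrow> real" where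
  "loss G z x i = (SUP x'\<in>strategies G. induced_util G z x' i) - induced_util G z x i"

definition optimal_against ::
  "('z, 'a, 'b) stackelberg \<Rightarrow> 'z \<Rightarrow> ('a \<Rightarrow> real) \<Rightarrow> nat \<Rightarrow> bool" where
  "optimal_against G z x i \<longleftrightarrow> loss G z x i = 0"

definition distinct_types :: "('z, 'a, 'b) stackelberg \<Rightarrow> nat \<Rightarrow> nat \<Rightarrow> bool" where
  "distinct_types G i j \<longleftrightarrow>
     (\<exists>z\<in>contexts G. \<not> (\<exists>x\<in>strategies G. optimal_against G z x i \<and> optimal_against G z x j))"

text \<open>
  The edges leaving a node are represented by a partial map from edge labels to subtrees, so
  distinct edges leaving the same node automatically have distinct labels.
\<close>

datatype ('z, 'y) ltree = Leaf | Node 'z "'y \<rightharpoonup> ('z, 'y) ltree"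

inductive littlestone_tree :: "'z set \<Rightarrow> 'y set \<Rightarrow> ('z, 'y) ltree \<Rightarrow> bool" for Z Y where
  Leaf: "littlestone_tree Z Y Leaf"
| Node: "littlestone_tree Z Y (Node z c)"
    if "z \<in> Z" "dom c \<noteq> {}" "dom c \<subseteq> Y" "\<forall>t\<in>ran c. littlestone_tree Z Y t"

text \<open>
  \<open>branch t p\<close>: \<open>p\<close> lists, along some path of \<open>t\<close> from the root to a leaf, each internal node
  label together with the label of the edge by which the path leaves that node.
\<close>

inductive branch :: "('z, 'y) ltree \<Rightarrow> ('z \<times> 'y) list \<Rightarrow> bool" where
  Leaf: "branch Leaf []"
| Node: "branch (Node z c) ((z, y) # p)" if "c y = Some t" "branch t p"

definition shattered :: "('z \<Rightarrow> 'y) set \<Rightarrow> ('z, 'y) ltree \<Rightarrow> bool" where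
  "shattered H t \<longleftrightarrow> (\<forall>p. branch t p \<longrightarrow> (\<exists>h\<in>H. \<forall>(z, y)\<in>set p. h z = y))"

text \<open>Binary trees in which all leaves are at the same depth.\<close>

inductive full_binary :: "nat \<Rightarrow> ('z, 'y) ltree \<Rightarrow> bool" where
  Leaf: "full_binary 0 Leaf"
| Node: "full_binary (Suc n) (Node z c)" if "card (dom c) = 2" "\<forall>t\<in>ran c. full_binary n t"

text \<open>
  The supremum in \<^typ>\<open>enat\<close> is the maximal depth if there is one, and \<open>\<infinity>\<close> if the depths are
  unbounded.  For the empty class, which shatters no tree, it is \<open>0\<close> by convention.
\<close>

definition Ldim :: "'z set \<Rightarrow> 'y set \<Rightarrow> ('z \<Rightarrow> 'y) set \<Rightarrow> enat" where
  "Ldim Z Y H = Sup {enat d |d. \<exists>t. littlestone_tree Z Y t \<and> full_binary d t \<and> shattered H t}"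

end

theory Submission imports Defs begin

text \<open>
  Two types that disagree at a single context \<open>z\<^sub>0\<close> are already distinct.  The hypothesis class
  consists of all labellings that agree at \<open>z\<^sub>0\<close>, so it is as rich as possible exactly at the
  contexts where the leader's utility is constant and the type of the follower is irrelevant.
\<close>

text \<open>All nodes of one level share a context, so a path is just a free choice of labels for
  \<open>s (n - 1)\<close>, ..., \<open>s 0\<close>, read from the root down.\<close>

fun level_tree :: "(nat \<Rightarrow> 'z) \<Rightarrow> 'y set \<Rightarrow> nat \<Rightarrow> ('z, 'y) ltree" where
  "level_tree s Y 0 = Leaf"
| "level_tree s Y (Suc n) = Node (s n) (\<lambda>y. if y \<in> Y then Some (level_tree s Y n) else None)"

lemma dom_level: "dom (\<lambda>y. if y \<in> Y then Some t else None) = Y"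
  by (auto split: if_splits)

lemma ran_level: "ran (\<lambda>y. if y \<in> Y then Some t else None) = (if Y = {} then {} else {t})"
  by (auto simp: ran_def split: if_splits)

lemma littlestone_level_tree:
  assumes "range s \<subseteq> Z" and "Y \<noteq> {}"
  shows "littlestone_tree Z Y (level_tree s Y n)"
proof (induction n)
  case 0
  show ?case by (simp add: littlestone_tree.Leaf)
next
  case (Suc n)
  show ?case
    unfolding level_tree.simps
    by (rule littlestone_tree.Node) (use assms Suc in \<open>auto simp: dom_level ran_level\<close>)
qed

lemma full_binary_level_tree:
  assumes "card Y = 2"
  shows "full_binary n (level_tree s Y n)"
proof (induction n)
  case 0
  show ?case by (simp add: full_binary.Leaf)
next
  case (Suc n)
  show ?case
    unfolding level_tree.simps
    by (rule full_binary.Node) (use assms Suc in \<open>simp_all add: dom_level ran_level\<close>)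
qed

text \<open>Injectivity of \<open>s\<close> keeps a context from recurring below itself. A path is
  therefore the graph of a finite partial function, and no two of its labels can conflict.\<close>

lemma branch_level_tree:
  assumes "inj s" and "branch (level_tree s Y n) p"
  shows "distinct (map fst p) \<and> fst ` set p \<subseteq> s ` {..<n} \<and> snd ` set p \<subseteq> Y"
  using assms(2)
proof (induction n arbitrary: p)
  case 0
  then show ?case by (auto elim: branch.cases)
next
  case (Suc n)
  from Suc.prems obtain y q where p: "p = (s n, y) # q" and y: "y \<in> Y"
    and q: "branch (level_tree s Y n) q"
    by (auto elim!: branch.cases[of "Node _ _"] split: if_splits)
  have IH: "distinct (map fst q)" "fst ` set q \<subseteq> s ` {..<n}" "snd ` set q \<subseteq> Y"
    using Suc.IH[OF q] by auto
  have "s n \<notin> s ` {..<n}"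
    using assms(1) by (auto dest: injD)
  with IH y show ?case
    unfolding p by (auto simp: lessThan_Suc)
qed

text \<open>Deleting \<open>z0\<close> leaves infinitely many contexts, and on these the class is
  unrestricted. Trees of every depth that avoid \<open>z0\<close> are therefore shattered.\<close>

lemma Ldim_fixed_value:
  assumes "infinite Z" and "z0 \<in> Z" and "card Y = 2" and "y0 \<in> Y"
  shows "Ldim Z Y {h \<in> Z \<rightarrow>\<^sub>E Y. h z0 = y0} = \<infinity>"
proof -
  have "infinite (Z - {z0})"
    using assms(1) by simp
  then obtain s :: "nat \<Rightarrow> _" where s: "inj s" "range s \<subseteq> Z - {z0}"
    using infinite_countable_subset by blast
  let ?H = "{h \<in> Z \<rightarrow>\<^sub>E Y. h z0 = y0}"
  let ?D = "{enat d |d. \<exists>t. littlestone_tree Z Y t \<and> full_binary d t \<and> shattered ?H t}"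
  have "enat n \<in> ?D" for n
  proof -
    have "shattered ?H (level_tree s Y n)"
      unfolding shattered_def
    proof (intro allI impI)
      fix p assume "branch (level_tree s Y n) p"
      note p = branch_level_tree[OF s(1) this]
      \<comment> \<open>The labels of the path are extended by the default \<open>y0\<close>. Since
        \<open>z0\<close> is not on the path, this default also yields the prescribed value
        there.\<close>
      define h where
        "h = (\<lambda>z\<in>Z. case map_of p z of None \<Rightarrow> y0 | Some y \<Rightarrow> y)"
      \<comment> \<open>Distinct contexts along \<open>p\<close> make \<open>map_of p\<close> return
        every listed label, not only the first one for its context.\<close>
      have "h z = y" if "(z, y) \<in> set p" for z y
        using that p s(2) by (force simp: h_def)
      moreover have "h \<in> ?H"
      proof -
        have "map_of p z0 = None"
          using p s(2) by (force simp: map_of_eq_None_iff)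
        moreover have "h \<in> Z \<rightarrow>\<^sub>E Y"
        proof -
          have "y \<in> Y" if "map_of p z = Some y" for z y
            using imageI[OF map_of_SomeD[OF that], of snd] p by (simp only: snd_conv) blast
          then show ?thesis
            using assms(4) by (auto simp: h_def split: option.split)
        qed
        ultimately show ?thesis
          using assms(2) by (simp add: h_def)
      qed
      ultimately show "\<exists>h\<in>?H. \<forall>(z, y)\<in>set p. h z = y"
        by blast
    qed
    moreover have "littlestone_tree Z Y (level_tree s Y n)"
      using s(2) assms(4) by (intro littlestone_level_tree) auto
    ultimately show ?thesis
      using full_binary_level_tree[OF assms(3)] by blast
  qed
  then have unbounded: "enat n \<le> Ldim Z Y ?H" for n
    unfolding Ldim_def by (intro Sup_upper)
  show ?thesis
  proof (cases "Ldim Z Y ?H")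
    case (enat m)
    with unbounded[of "Suc m"] show ?thesis by simp
  qed simp
qed

text \<open>Every follower reveals its type by its action. Only at \<open>z0\<close> does the leader
  gain, namely by guessing that type; at all other contexts every strategy is optimal.\<close>

definition matching_game :: "'z set \<Rightarrow> 'z \<Rightarrow> nat \<Rightarrow> ('z, nat, nat) stackelberg" where
  "matching_game Z z0 K =
     \<lparr>leader_actions = {1..K}, follower_actions = {1..K}, contexts = Z, num_types = K,
      leader_util = (\<lambda>z a b. if z = z0 \<and> a = b then 1 else 0),
      follower_util = (\<lambda>i z a b. if b = i then 1 else 0),
      tie_order = {(b, b'). b \<in> {1..K} \<and> b' \<in> {1..K} \<and> b \<le> b'}\<rparr>"

lemma matching_game_simps [simp]:
  "leader_actions (matching_game Z z0 K) = {1..K}"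
  "follower_actions (matching_game Z z0 K) = {1..K}"
  "contexts (matching_game Z z0 K) = Z"
  "types (matching_game Z z0 K) = {1..K}"
  by (simp_all add: matching_game_def types_def)

lemma stackelberg_matching_game:
  assumes "K > 0"
  shows "stackelberg_game (matching_game Z z0 K)"
  using assms
  by (auto simp: stackelberg_game_def matching_game_def linear_order_on_def
      partial_order_on_def preorder_on_def refl_on_def trans_def antisym_def total_on_def)

text \<open>The weights of \<open>x\<close> sum to 1, so the follower's utility does not depend on
  \<open>x\<close>. Action \<open>i\<close> is then the unique maximiser and no tie arises.\<close>

lemma best_response_matching_game:
  assumes "x \<in> prob_simplex {1..K}" and "i \<in> {1..K}"
  shows "best_response (matching_game Z z0 K) i z x = i"
proof -
  let ?G = "matching_game Z z0 K"
  have "mixed_util ?G (follower_util ?G i) z x b = (if b = i then 1 else 0)" for b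
    using assms(1) by (simp add: mixed_util_def prob_simplex_def) (simp add: matching_game_def)
  then have "best_responses ?G i z x = {i}"
    using assms(2) by (auto simp: best_responses_def split: if_splits)
  then show ?thesis
    using assms(2) by (auto simp: best_response_def matching_game_def)
qed

lemma induced_util_matching_game:
  assumes "x \<in> prob_simplex {1..K}" and "i \<in> {1..K}"
  shows "induced_util (matching_game Z z0 K) z x i = (if z = z0 then x i else 0)"
proof -
  have "(\<Sum>a\<in>{1..K}. x a * (if z = z0 \<and> a = i then 1 else 0)) = (if z = z0 then x i else 0)"
    using assms(2) by (simp add: if_distrib cong: if_cong)
  then show ?thesis
    unfolding induced_util_def best_response_matching_game[OF assms] mixed_util_def
    by (simp add: matching_game_def)
qed

text \<open>Restricted to \<open>A\<close> because members of \<open>prob_simplex A\<close> are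
  extensional functions.\<close>

definition point_mass :: "'a set \<Rightarrow> 'a \<Rightarrow> 'a \<Rightarrow> real" where
  "point_mass A i = (\<lambda>a\<in>A. if a = i then 1 else 0)"

lemma point_mass_in_prob_simplex:
  assumes "finite A" and "i \<in> A"
  shows "point_mass A i \<in> prob_simplex A"
  using assms by (auto simp: point_mass_def prob_simplex_def)

lemma prob_simplex_le_1:
  assumes "finite A" and "x \<in> prob_simplex A" and "i \<in> A"
  shows "x i \<le> 1"
proof -
  have "x i \<le> sum x A"
    using assms by (intro member_le_sum) (auto simp: prob_simplex_def)
  then show ?thesis
    using assms(2) by (simp add: prob_simplex_def)
qed

text \<open>At \<open>z0\<close> the leader earns \<open>x i\<close>, which is at most 1, with
  equality for the point mass at \<open>i\<close>.\<close>

lemma loss_matching_game: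
  assumes x: "x \<in> prob_simplex {1..K}" and i: "i \<in> {1..K}"
  shows "loss (matching_game Z z0 K) z x i = (if z = z0 then 1 - x i else 0)"
proof -
  let ?S = "prob_simplex {1..K}"
  have "(SUP x'\<in>?S. induced_util (matching_game Z z0 K) z x' i)
      = (SUP x'\<in>?S. if z = z0 then x' i else 0)"
    using i by (intro SUP_cong refl induced_util_matching_game)
  also have "\<dots> = (if z = z0 then 1 else 0)"
  proof (cases "z = z0")
    case True
    have "(SUP x'\<in>?S. x' i) = 1"
    proof (rule cSup_eq_maximum)
      show "1 \<in> (\<lambda>x'. x' i) ` ?S"
        using point_mass_in_prob_simplex[of "{1..K}" i] i
        by (intro rev_image_eqI[of "point_mass {1..K} i"]) (auto simp: point_mass_def)
    qed (use i prob_simplex_le_1[of "{1..K}"] in auto)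
    with True show ?thesis by simp
  next
    case False
    \<comment> \<open>A real supremum of the constant 0 is known to be 0 only over a nonempty index
      set.\<close>
    have "?S \<noteq> {}" using x by auto
    with False show ?thesis by simp
  qed
  finally show ?thesis
    by (simp add: loss_def induced_util_matching_game[OF assms])
qed

text \<open>Optimality at \<open>z0\<close> against both types would put mass 1 on each of two
  actions, exceeding the total mass 1.\<close>

lemma distinct_types_matching_game:
  assumes "z0 \<in> Z"
  shows "pairwise (distinct_types (matching_game Z z0 K)) {1..K}"
proof (rule pairwiseI)
  fix i j assume ij: "i \<in> {1..K}" "j \<in> {1..K}" "i \<noteq> j"
  have "\<not> (x i = 1 \<and> x j = 1)" if "x \<in> prob_simplex {1..K}" for x
  proof -
    have "sum x {i, j} \<le> sum x {1..K}"
      using that ij by (intro sum_mono2) (auto simp: prob_simplex_def PiE_iff)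
    then show ?thesis
      using that ij(3) by (auto simp: prob_simplex_def)
  qed
  then show "distinct_types (matching_game Z z0 K) i j"
    unfolding distinct_types_def optimal_against_def
    using assms ij loss_matching_game[of _ K _ Z z0 z0]
    by (intro bexI[of _ z0]) auto
qed

text \<open>The coordinate map is onto the reals. This supplies the infinite context set that
  \<open>Ldim_fixed_value\<close> requires.\<close>

lemma infinite_carrier_vec_1: "infinite (carrier_vec 1 :: real vec set)"
proof
  assume "finite (carrier_vec 1 :: real vec set)"
  then have "finite ((\<lambda>v. v $ 0) ` (carrier_vec 1 :: real vec set))"
    by simp
  moreover have "(\<lambda>v. v $ 0) ` (carrier_vec 1 :: real vec set) = UNIV"
  proof (intro equalityI subset_UNIV subsetI)
    fix c :: real
    show "c \<in> (\<lambda>v. v $ 0) ` carrier_vec 1"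
      by (rule image_eqI[of _ _ "vec 1 (\<lambda>_. c)"]) auto
  qed
  ultimately show False
    using infinite_UNIV_char_0[where 'a = real] by simp
qed

theorem theorem3p5:
  "\<exists>(d :: nat) (G :: (real vec, nat, nat) stackelberg) (H :: (real vec \<Rightarrow> nat) set).
     stackelberg_game G \<and> contexts G \<subseteq> carrier_vec d \<and>
     pairwise (distinct_types G) (types G) \<and>
     H \<subseteq> contexts G \<rightarrow>\<^sub>E types G \<and>
     Ldim (contexts G) (types G) H = \<infinity> \<and>
     (\<exists>\<pi>. \<pi> \<in> contexts G \<rightarrow> strategies G \<and>
        (\<forall>h\<in>H. \<forall>z\<in>contexts G. loss G z (\<pi> z) (h z) = 0))"
proof -
  \<comment> \<open>Dimension 1 already gives infinitely many contexts, and two types make the level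
    trees binary. The origin is an arbitrary choice of special context.\<close>
  let ?Z = "carrier_vec 1 :: real vec set" and ?z0 = "0\<^sub>v 1 :: real vec"
  let ?G = "matching_game ?Z ?z0 2"
  let ?H = "{h \<in> ?Z \<rightarrow>\<^sub>E {1..2::nat}. h ?z0 = 1}"
  \<comment> \<open>The policy is constantly this strategy: it is optimal against type 1, the type
    that every hypothesis predicts at \<open>?z0\<close>.\<close>
  let ?x = "point_mass {1..2::nat} 1"
  have x: "?x \<in> prob_simplex {1..2}" "?x 1 = 1"
    by (simp_all add: point_mass_in_prob_simplex) (simp add: point_mass_def)
  have "loss ?G z ?x (h z) = 0" if "h \<in> ?H" "z \<in> ?Z" for h z
  proof -
    have "h z \<in> {1..2}" and "h ?z0 = 1"
      using that by auto
    then show ?thesis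
      using x by (auto simp: loss_matching_game)
  qed
  then have "\<exists>\<pi>. \<pi> \<in> contexts ?G \<rightarrow> strategies ?G \<and>
      (\<forall>h\<in>?H. \<forall>z\<in>contexts ?G. loss ?G z (\<pi> z) (h z) = 0)"
    using x(1) by (intro exI[of _ "\<lambda>_. ?x"]) simp
  moreover have "Ldim (contexts ?G) (types ?G) ?H = \<infinity>"
    using Ldim_fixed_value[OF infinite_carrier_vec_1, of ?z0 "{1..2::nat}" 1] by simp
  moreover have "stackelberg_game ?G"
    by (simp add: stackelberg_matching_game)
  moreover have "pairwise (distinct_types ?G) (types ?G)"
    using distinct_types_matching_game[of ?z0 ?Z 2] by simp
  moreover have "?H \<subseteq> contexts ?G \<rightarrow>\<^sub>E types ?G" "contexts ?G \<subseteq> carrier_vec 1"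
    by auto
  ultimately show ?thesis
    by blast
qed

end
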